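(* Let $\mathbf{T}\equiv(T_1,T_2)\in\mathcal{SFC}$ with data $x_0,x_1,\dots$; $y_0,y_1,\dots$; $a$. Then $\mathbf{T}$ is (jointly) hyponormal if and only if $$y_0\leq h:=\sqrt{\frac{x_0^2y_1^2(x_1^2-x_0^2)}{x_0^2(x_1^2-x_0^2)+(a^2-x_0^2)^2}}.$$
   Context: $2$-variable weighted shifts: for bounded families of positive numbers $\{\alpha_{\mathbf{k}}\},\{\beta_{\mathbf{k}}\}$, $\mathbf{k}\in\mathbb{Z}_+^2$, the pair $\mathbf{T}\equiv(T_1,T_2)$ on $\ell^2(\mathbb{Z}_+^2)$ is $T_1e_{\mathbf{k}}=\alpha_{\mathbf{k}}e_{\mathbf{k}+(1,0)}$, $T_2e_{\mathbf{k}}=\beta_{\mathbf{k}}e_{\mathbf{k}+(0,1)}$; it is commuting iff $\beta_{\mathbf{k}+(1,0)}\alpha_{\mathbf{k}}=\alpha_{\mathbf{k}+(0,1)}\beta_{\mathbf{k}}$ for all $\mathbf{k}$. With $[S,T]:=ST-TS$, a commuting pair is (jointly) hyponormal if $\begin{pmatrix}[T_1^*,T_1]&[T_2^*,T_1]\\ [T_1^*,T_2]&[T_2^*,T_2]\end{pmatrix}\geq0$. An operator is subnormal if it is the restriction of a normal operator to an invariant subspace. $shift(\omega_0,\omega_1,\dots)$ is the unilateral weighted shift $e_k\mapsto\omega_ke_{k+1}$ on $\ell^2(\mathbb{Z}_+)$; when it is subnormal, its Berger measure is the unique compactly supported probability measure $\xi$ on $[0,\infty)$ with $\omega_0^2\cdots\omega_{k-1}^2=\int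 t^k\,d\xi(t)$ for all $k\geq 1$. The class $\mathcal{SFC}$ (symmetrically flat, contractive, with subnormal coordinates) consists of the commuting $2$-variable weighted shifts with $\alpha_{\mathbf{k}}=\beta_{\mathbf{k}}=1$ for all $\mathbf{k}=(k_1,k_2)$ with $k_1,k_2\geq1$, $\|T_1\|\leq1$, $\|T_2\|\leq1$, and $T_1$, $T_2$ subnormal. Notation: $x_n:=\alpha_{(n,0)}$, $y_n:=\beta_{(0,n)}$, $a:=\alpha_{(0,1)}$; $\xi$ and $\eta$ are the Berger measures of $shift(x_0,x_1,\dots)$ and $shift(y_0,y_1,\dots)$. By commutativity the remaining weights are $\alpha_{(0,n)}=a/(y_1\cdots y_{n-1})$ for $n\geq2$ and $\beta_{(n,0)}=ay_0/(x_0\cdots x_{n-1})$ for $n\geq1$. Standing assumption of the paper: $\xi=p\delta_0+q\delta_1+[1-(p+q)]\rho$ and $\eta=u\delta_0+v\delta_1+[1-(u+v)]\sigma$, where $0<p,q,u,v<1$, $p+q\leq1$, $u+v\leq1$, and $\rho,\sigma$ are probability measures with $\rho(\{0\}\cup\{1\})=\sigma(\{0\}\cup\{1\})=0$. *)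

theory Defs
  imports "HOL-Analysis.Analysis" "HOL-Probability.Probability"
begin

section \<open>Complex Hilbert spaces\<close>

text \<open>
  The underlying real Hilbert space is the library's; its inner product is the real part of the
  complex one, so the norm, the topology and the operator norm \<^const>\<open>onorm\<close> are those of the
  library.  The complex inner product is linear in its first argument.
\<close>

class complex_hilbert_space = real_inner + complete_space +
  fixes scaleC :: "complex \<Rightarrow> 'a \<Rightarrow> 'a" (infixr \<open>*\<^sub>C\<close> 75)
    and cinner :: "'a \<Rightarrow> 'a \<Rightarrow> complex"
  assumes scaleC_add_right: "c *\<^sub>C (x + y) = c *\<^sub>C x + c *\<^sub>C y"
    and scaleC_add_left: "(c + d) *\<^sub>C x = c *\<^sub>C x + d *\<^sub>C x"
    and scaleC_scaleC: "c *\<^sub>C d *\<^sub>C x = (c * d) *\<^sub>C x"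
    and scaleC_of_real: "complex_of_real r *\<^sub>C x = r *\<^sub>R x"
    and cinner_add_left: "cinner (x + y) z = cinner x z + cinner y z"
    and cinner_scaleC_left: "cinner (c *\<^sub>C x) y = c * cinner x y"
    and cinner_commute: "cinner x y = cnj (cinner y x)"
    and Re_cinner: "Re (cinner x y) = inner x y"

instantiation prod :: (complex_hilbert_space, complex_hilbert_space) complex_hilbert_space
begin

definition scaleC_prod :: "complex \<Rightarrow> 'a \<times> 'b \<Rightarrow> 'a \<times> 'b" where
  "scaleC_prod c x = (c *\<^sub>C fst x, c *\<^sub>C snd x)"

definition cinner_prod :: "'a \<times> 'b \<Rightarrow> 'a \<times> 'b \<Rightarrow> complex" where
  "cinner_prod x y = cinner (fst x) (fst y) + cinner (snd x) (snd y)"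

instance
proof
  fix x y z :: "'a \<times> 'b" and c d :: complex and r :: real
  show "cinner x y = cnj (cinner y x)"
    unfolding cinner_prod_def complex_cnj_add
    by (metis cinner_commute)
qed (simp_all add: scaleC_prod_def cinner_prod_def scaleC_add_right scaleC_add_left
      scaleC_scaleC scaleC_of_real cinner_add_left cinner_scaleC_left Re_cinner
      inner_prod_def scaleR_prod_def distrib_left)

end


section \<open>The Hilbert space of square-summable families\<close>

typedef 'i ell2 = "{f :: 'i \<Rightarrow> complex. (\<lambda>i. (cmod (f i))\<^sup>2) summable_on UNIV}"
  morphisms ell2_nth Abs_ell2
  by (rule exI[of _ "\<lambda>_. 0"]) simp

setup_lifting type_definition_ell2

lemma ell2_summable: "(\<lambda>i. (cmod (ell2_nth f i))\<^sup>2) summable_on UNIV"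
  using ell2_nth[of f] by simp

lemma ell2_eqI: "(\<And>i. ell2_nth f i = ell2_nth g i) \<Longrightarrow> f = g"
  by (metis ell2_nth_inject ext)

lemma square_summable_add:
  fixes f g :: "'i \<Rightarrow> complex"
  assumes "(\<lambda>i. (cmod (f i))\<^sup>2) summable_on UNIV" "(\<lambda>i. (cmod (g i))\<^sup>2) summable_on UNIV"
  shows "(\<lambda>i. (cmod (f i + g i))\<^sup>2) summable_on UNIV"
proof (rule summable_on_comparison_test)
  show "(\<lambda>i. 2 * (cmod (f i))\<^sup>2 + 2 * (cmod (g i))\<^sup>2) summable_on UNIV"
    by (intro summable_on_add summable_on_cmult_right assms)
  fix i
  have "(cmod (f i + g i))\<^sup>2 \<le> (cmod (f i) + cmod (g i))\<^sup>2"
    by (intro power_mono norm_triangle_ineq) auto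
  also have "\<dots> \<le> 2 * (cmod (f i))\<^sup>2 + 2 * (cmod (g i))\<^sup>2"
    using sum_squares_bound[of "cmod (f i)" "cmod (g i)"] by (simp add: power2_sum)
  finally show "(cmod (f i + g i))\<^sup>2 \<le> 2 * (cmod (f i))\<^sup>2 + 2 * (cmod (g i))\<^sup>2" .
qed auto

lemma square_summable_scale:
  fixes f :: "'i \<Rightarrow> complex"
  assumes "(\<lambda>i. (cmod (f i))\<^sup>2) summable_on UNIV"
  shows "(\<lambda>i. (cmod (c * f i))\<^sup>2) summable_on UNIV"
  using summable_on_cmult_right[OF assms, of "(cmod c)\<^sup>2"]
  by (simp add: norm_mult power_mult_distrib)

lemma ell2_product_summable:
  "(\<lambda>i. ell2_nth f i * cnj (ell2_nth g i)) summable_on UNIV"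
proof (rule Infinite_Sum.abs_summable_summable, rule Infinite_Sum.abs_summable_on_comparison_test')
  show "(\<lambda>i. (cmod (ell2_nth f i))\<^sup>2 + (cmod (ell2_nth g i))\<^sup>2) summable_on UNIV"
    by (intro summable_on_add ell2_summable)
  fix i
  have "cmod (ell2_nth f i) * cmod (ell2_nth g i) * 2
      \<le> (cmod (ell2_nth f i))\<^sup>2 + (cmod (ell2_nth g i))\<^sup>2"
    using sum_squares_bound[of "cmod (ell2_nth f i)" "cmod (ell2_nth g i)"]
    by (simp add: mult_ac)
  moreover have "0 \<le> cmod (ell2_nth f i) * cmod (ell2_nth g i)" by simp
  ultimately show "cmod (ell2_nth f i * cnj (ell2_nth g i))
      \<le> (cmod (ell2_nth f i))\<^sup>2 + (cmod (ell2_nth g i))\<^sup>2"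
    unfolding norm_mult complex_mod_cnj by linarith
qed

instantiation ell2 :: (type) real_vector
begin

lift_definition zero_ell2 :: "'a ell2" is "\<lambda>_. 0" by simp
lift_definition plus_ell2 :: "'a ell2 \<Rightarrow> 'a ell2 \<Rightarrow> 'a ell2" is "\<lambda>f g i. f i + g i"
  by (rule square_summable_add)
lift_definition uminus_ell2 :: "'a ell2 \<Rightarrow> 'a ell2" is "\<lambda>f i. - f i" by simp
lift_definition scaleR_ell2 :: "real \<Rightarrow> 'a ell2 \<Rightarrow> 'a ell2" is "\<lambda>r f i. complex_of_real r * f i"
  by (rule square_summable_scale)

definition minus_ell2 :: "'a ell2 \<Rightarrow> 'a ell2 \<Rightarrow> 'a ell2" where
  "minus_ell2 f g = f + - g"

lemmas ell2_nth_ops = zero_ell2.rep_eq plus_ell2.rep_eq uminus_ell2.rep_eq scaleR_ell2.rep_eq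

instance
proof
  fix f g h :: "'a ell2" and r s :: real
  show "f + g + h = f + (g + h)" by (rule ell2_eqI) (simp add: ell2_nth_ops add_ac)
  show "f + g = g + f" by (rule ell2_eqI) (simp add: ell2_nth_ops add_ac)
  show "0 + f = f" by (rule ell2_eqI) (simp add: ell2_nth_ops)
  show "- f + f = 0" by (rule ell2_eqI) (simp add: ell2_nth_ops)
  show "f - g = f + - g" by (rule minus_ell2_def)
  show "r *\<^sub>R (f + g) = r *\<^sub>R f + r *\<^sub>R g" by (rule ell2_eqI) (simp add: ell2_nth_ops distrib_left)
  show "(r + s) *\<^sub>R f = r *\<^sub>R f + s *\<^sub>R f" by (rule ell2_eqI) (simp add: ell2_nth_ops distrib_right)
  show "r *\<^sub>R s *\<^sub>R f = (r * s) *\<^sub>R f" by (rule ell2_eqI) (simp add: ell2_nth_ops mult_ac)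
  show "1 *\<^sub>R f = f" by (rule ell2_eqI) (simp add: ell2_nth_ops)
qed

end

instantiation ell2 :: (type) real_inner
begin

definition inner_ell2 :: "'a ell2 \<Rightarrow> 'a ell2 \<Rightarrow> real" where
  "inner_ell2 f g = Re (\<Sum>\<^sub>\<infinity>i. ell2_nth f i * cnj (ell2_nth g i))"
definition norm_ell2 :: "'a ell2 \<Rightarrow> real" where
  "norm_ell2 f = sqrt (inner f f)"
definition dist_ell2 :: "'a ell2 \<Rightarrow> 'a ell2 \<Rightarrow> real" where
  "dist_ell2 f g = norm (f - g)"
definition sgn_ell2 :: "'a ell2 \<Rightarrow> 'a ell2" where
  "sgn_ell2 f = f /\<^sub>R norm f"
definition uniformity_ell2 :: "('a ell2 \<times> 'a ell2) filter" where
  "uniformity_ell2 = (INF e\<in>{0<..}. principal {(f, g). dist f g < e})"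
definition open_ell2 :: "'a ell2 set \<Rightarrow> bool" where
  "open_ell2 U \<longleftrightarrow> (\<forall>f\<in>U. \<forall>\<^sub>F (f', g) in uniformity. f' = f \<longrightarrow> g \<in> U)"

lemma ell2_inner_self: "inner f f = (\<Sum>\<^sub>\<infinity>i. (cmod (ell2_nth f i))\<^sup>2)" for f :: "'a ell2"
proof -
  have "inner f f = (\<Sum>\<^sub>\<infinity>i. Re (ell2_nth f i * cnj (ell2_nth f i)))"
    unfolding inner_ell2_def by (rule infsum_Re[symmetric, OF ell2_product_summable])
  thus ?thesis by (simp only: complex_norm_square[symmetric] Re_complex_of_real)
qed

instance
proof
  fix f g h :: "'a ell2" and r :: real
  show "dist f g = norm (f - g)" by (rule dist_ell2_def)
  show "sgn f = f /\<^sub>R norm f" by (rule sgn_ell2_def)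
  show "(uniformity :: ('a ell2 \<times> 'a ell2) filter) = (INF e\<in>{0<..}. principal {(f, g). dist f g < e})"
    by (rule uniformity_ell2_def)
  show "open U \<longleftrightarrow> (\<forall>f\<in>U. \<forall>\<^sub>F (f', g) in uniformity. f' = f \<longrightarrow> g \<in> U)" for U :: "'a ell2 set"
    by (rule open_ell2_def)
  show "norm f = sqrt (inner f f)" by (rule norm_ell2_def)
  have "(\<Sum>\<^sub>\<infinity>i. ell2_nth f i * cnj (ell2_nth g i)) = cnj (\<Sum>\<^sub>\<infinity>i. ell2_nth g i * cnj (ell2_nth f i))"
    by (subst infsum_cnj[symmetric]) (simp add: mult.commute)
  thus "inner f g = inner g f" by (simp add: inner_ell2_def)
  show "inner (f + g) h = inner f h + inner g h"
    by (simp add: inner_ell2_def plus_ell2.rep_eq distrib_right infsum_add ell2_product_summable)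
  show "inner (r *\<^sub>R f) g = r * inner f g"
    by (simp add: inner_ell2_def scaleR_ell2.rep_eq mult.assoc infsum_cmult_right')
  show "0 \<le> inner f f" by (simp add: ell2_inner_self infsum_nonneg)
  show "inner f f = 0 \<longleftrightarrow> f = 0"
  proof
    assume "inner f f = 0"
    hence "(cmod (ell2_nth f i))\<^sup>2 = 0" for i
      using nonneg_infsum_le_0D[OF _ ell2_summable, of f i] by (simp add: ell2_inner_self)
    thus "f = 0" by (intro ell2_eqI) (simp add: zero_ell2.rep_eq)
  next
    assume "f = 0"
    hence "\<And>i. (cmod (ell2_nth f i))\<^sup>2 = 0" by (simp add: zero_ell2.rep_eq)
    thus "inner f f = 0" unfolding ell2_inner_self by (rule infsum_0)
  qed
qed

end

lemma ell2_nth_diff: "ell2_nth (f - g) i = ell2_nth f i - ell2_nth g i"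
  unfolding minus_ell2_def plus_ell2.rep_eq uminus_ell2.rep_eq by simp

lemma ell2_norm_sq: "(norm f)\<^sup>2 = (\<Sum>\<^sub>\<infinity>i. (cmod (ell2_nth f i))\<^sup>2)" for f :: "'i ell2"
  by (metis ell2_inner_self power2_norm_eq_inner)

lemma ell2_sum_le_norm_sq:
  fixes f :: "'i ell2"
  assumes "finite F"
  shows "(\<Sum>i\<in>F. (cmod (ell2_nth f i))\<^sup>2) \<le> (norm f)\<^sup>2"
  unfolding ell2_norm_sq by (rule finite_sum_le_infsum[OF ell2_summable assms]) auto

lemma ell2_nth_le_norm: "cmod (ell2_nth f i) \<le> norm f" for f :: "'i ell2"
  using ell2_sum_le_norm_sq[of "{i}" f] by (simp add: power2_le_iff_abs_le)

instance ell2 :: (type) complete_space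
proof
  fix X :: "nat \<Rightarrow> 'a ell2"
  assume X: "Cauchy X"
  have "Cauchy (\<lambda>n. ell2_nth (X n) i)" for i
  proof (rule metric_CauchyI)
    fix e :: real
    assume "0 < e"
    then obtain M where M: "\<And>m n. m \<ge> M \<Longrightarrow> n \<ge> M \<Longrightarrow> dist (X m) (X n) < e"
      using metric_CauchyD[OF X] by metis
    have "dist (ell2_nth (X m) i) (ell2_nth (X n) i) < e" if "m \<ge> M" "n \<ge> M" for m n
      using M[OF that] ell2_nth_le_norm[of "X m - X n" i]
      by (simp add: dist_norm ell2_nth_diff)
    thus "\<exists>M. \<forall>m\<ge>M. \<forall>n\<ge>M. dist (ell2_nth (X m) i) (ell2_nth (X n) i) < e"
      by blast
  qed
  note coordinate_Cauchy = this
  define l where "l i = lim (\<lambda>n. ell2_nth (X n) i)" for i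
  have l: "(\<lambda>n. ell2_nth (X n) i) \<longlonglongrightarrow> l i" for i
    using coordinate_Cauchy[of i] by (simp add: l_def Cauchy_convergent_iff convergent_LIMSEQ_iff)
  have tail: "\<exists>M. \<forall>m\<ge>M. \<forall>F. finite F \<longrightarrow> (\<Sum>i\<in>F. (cmod (ell2_nth (X m) i - l i))\<^sup>2) \<le> e\<^sup>2"
    if "0 < e" for e :: real
  proof -
    obtain M where M: "\<And>m n. m \<ge> M \<Longrightarrow> n \<ge> M \<Longrightarrow> dist (X m) (X n) < e"
      using metric_CauchyD[OF X \<open>0 < e\<close>] by metis
    have "(\<Sum>i\<in>F. (cmod (ell2_nth (X m) i - l i))\<^sup>2) \<le> e\<^sup>2" if "m \<ge> M" "finite F" for m F
    proof (rule LIMSEQ_le_const2)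
      show "(\<lambda>n. \<Sum>i\<in>F. (cmod (ell2_nth (X m) i - ell2_nth (X n) i))\<^sup>2)
          \<longlonglongrightarrow> (\<Sum>i\<in>F. (cmod (ell2_nth (X m) i - l i))\<^sup>2)"
        by (intro tendsto_intros l)
      have "(\<Sum>i\<in>F. (cmod (ell2_nth (X m) i - ell2_nth (X n) i))\<^sup>2) \<le> e\<^sup>2" if "n \<ge> M" for n
      proof -
        have "(\<Sum>i\<in>F. (cmod (ell2_nth (X m) i - ell2_nth (X n) i))\<^sup>2) \<le> (norm (X m - X n))\<^sup>2"
          using ell2_sum_le_norm_sq[OF \<open>finite F\<close>, of "X m - X n"] by (simp add: ell2_nth_diff)
        also have "\<dots> \<le> e\<^sup>2"
          using M[OF \<open>m \<ge> M\<close> \<open>n \<ge> M\<close>] by (intro power_mono) (auto simp: dist_norm)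
        finally show ?thesis .
      qed
      thus "\<exists>N. \<forall>n\<ge>N. (\<Sum>i\<in>F. (cmod (ell2_nth (X m) i - ell2_nth (X n) i))\<^sup>2) \<le> e\<^sup>2"
        by blast
    qed
    thus ?thesis by blast
  qed
  have summ: "(\<lambda>i. (cmod (ell2_nth (X m) i - l i))\<^sup>2) summable_on UNIV"
    if "\<And>F. finite F \<Longrightarrow> (\<Sum>i\<in>F. (cmod (ell2_nth (X m) i - l i))\<^sup>2) \<le> e\<^sup>2" for m e
    by (rule nonneg_bdd_above_summable_on) (auto intro!: bdd_aboveI2[where M = "e\<^sup>2"] that)
  obtain M1 where M1: "\<And>F. finite F \<Longrightarrow> (\<Sum>i\<in>F. (cmod (ell2_nth (X M1) i - l i))\<^sup>2) \<le> 1\<^sup>2"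
    using tail[OF zero_less_one] by blast
  have "(\<lambda>i. (cmod (l i))\<^sup>2) summable_on UNIV"
    using square_summable_add[OF ell2_summable[of "X M1"]
        square_summable_scale[OF summ[OF M1], of "- 1"]] by simp
  hence L: "ell2_nth (Abs_ell2 l) = l"
    by (simp add: Abs_ell2_inverse)
  have "X \<longlonglongrightarrow> Abs_ell2 l"
  proof (rule metric_LIMSEQ_I)
    fix e :: real
    assume "0 < e"
    then obtain M where M: "\<And>m F. m \<ge> M \<Longrightarrow> finite F
        \<Longrightarrow> (\<Sum>i\<in>F. (cmod (ell2_nth (X m) i - l i))\<^sup>2) \<le> (e / 2)\<^sup>2"
      using tail[OF half_gt_zero] by blast
    have "dist (X m) (Abs_ell2 l) < e" if "m \<ge> M" for m
    proof -
      have "(norm (X m - Abs_ell2 l))\<^sup>2 \<le> (e / 2)\<^sup>2"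
        unfolding ell2_norm_sq ell2_nth_diff L
        by (rule infsum_le_finite_sums[OF summ[OF M[OF that]]]) (auto intro: M[OF that])
      hence "norm (X m - Abs_ell2 l) \<le> e / 2"
        by (rule power2_le_imp_le) (use \<open>0 < e\<close> in simp)
      thus ?thesis using \<open>0 < e\<close> by (simp add: dist_norm)
    qed
    thus "\<exists>M. \<forall>m\<ge>M. dist (X m) (Abs_ell2 l) < e" by blast
  qed
  thus "convergent X" by (rule convergentI)
qed

instantiation ell2 :: (type) complex_hilbert_space
begin

lift_definition scaleC_ell2 :: "complex \<Rightarrow> 'a ell2 \<Rightarrow> 'a ell2" is "\<lambda>c f i. c * f i"
  by (rule square_summable_scale)

definition cinner_ell2 :: "'a ell2 \<Rightarrow> 'a ell2 \<Rightarrow> complex" where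
  "cinner_ell2 f g = (\<Sum>\<^sub>\<infinity>i. ell2_nth f i * cnj (ell2_nth g i))"

instance
proof
  fix f g h :: "'a ell2" and c d :: complex and r :: real
  show "c *\<^sub>C (f + g) = c *\<^sub>C f + c *\<^sub>C g" by (rule ell2_eqI) (simp add: ell2_nth_ops scaleC_ell2.rep_eq distrib_left)
  show "(c + d) *\<^sub>C f = c *\<^sub>C f + d *\<^sub>C f" by (rule ell2_eqI) (simp add: ell2_nth_ops scaleC_ell2.rep_eq distrib_right)
  show "c *\<^sub>C d *\<^sub>C f = (c * d) *\<^sub>C f" by (rule ell2_eqI) (simp add: ell2_nth_ops scaleC_ell2.rep_eq mult_ac)
  show "complex_of_real r *\<^sub>C f = r *\<^sub>R f" by (rule ell2_eqI) (simp add: ell2_nth_ops scaleC_ell2.rep_eq)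
  show "cinner (f + g) h = cinner f h + cinner g h"
    by (simp add: cinner_ell2_def plus_ell2.rep_eq distrib_right infsum_add ell2_product_summable)
  show "cinner (c *\<^sub>C f) g = c * cinner f g"
    by (simp add: cinner_ell2_def scaleC_ell2.rep_eq mult.assoc infsum_cmult_right')
  show "cinner f g = cnj (cinner g f)"
    unfolding cinner_ell2_def by (subst infsum_cnj[symmetric]) (simp add: mult.commute)
  show "Re (cinner f g) = inner f g" by (simp add: cinner_ell2_def inner_ell2_def)
qed

end

lift_definition ket :: "'i \<Rightarrow> 'i ell2" is "\<lambda>k i. if i = k then 1 else 0"
proof -
  fix k :: 'i
  have "(\<lambda>i. (cmod (if i = k then 1 else 0))\<^sup>2) summable_on {k}" by simp
  thus "(\<lambda>i. (cmod (if i = k then 1 else 0))\<^sup>2) summable_on UNIV"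
    by (subst summable_on_cong_neutral[where T = "{k}"]) auto
qed


section \<open>Operators\<close>

definition bounded_clinear :: "('a::complex_hilbert_space \<Rightarrow> 'b::complex_hilbert_space) \<Rightarrow> bool" where
  "bounded_clinear T \<longleftrightarrow> bounded_linear T \<and> (\<forall>c x. T (c *\<^sub>C x) = c *\<^sub>C T x)"

text \<open>For a bounded operator the adjoint exists by the Riesz theorem and is unique.\<close>

definition cadjoint ::
    "('a::complex_hilbert_space \<Rightarrow> 'b::complex_hilbert_space) \<Rightarrow> 'b \<Rightarrow> 'a" where
  "cadjoint T = (SOME S. \<forall>x y. cinner (S x) y = cinner x (T y))"

definition commutator :: "('a::ab_group_add \<Rightarrow> 'a) \<Rightarrow> ('a \<Rightarrow> 'a) \<Rightarrow> 'a \<Rightarrow> 'a" where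
  "commutator S T = (\<lambda>x. S (T x) - T (S x))"

definition positive_operator :: "('a::complex_hilbert_space \<Rightarrow> 'a) \<Rightarrow> bool" where
  "positive_operator A \<longleftrightarrow> (\<forall>x. cinner (A x) x \<in> \<real>\<^sub>\<ge>\<^sub>0)"

definition operator_matrix ::
    "('a::ab_group_add \<Rightarrow> 'a) \<Rightarrow> ('a \<Rightarrow> 'a) \<Rightarrow> ('a \<Rightarrow> 'a) \<Rightarrow> ('a \<Rightarrow> 'a) \<Rightarrow> 'a \<times> 'a \<Rightarrow> 'a \<times> 'a" where
  "operator_matrix A B C D = (\<lambda>(x, y). (A x + B y, C x + D y))"

definition jointly_hyponormal ::
    "('a::complex_hilbert_space \<Rightarrow> 'a) \<Rightarrow> ('a \<Rightarrow> 'a) \<Rightarrow> bool" where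
  "jointly_hyponormal T1 T2 \<longleftrightarrow> positive_operator
     (operator_matrix
       (commutator (cadjoint T1) T1) (commutator (cadjoint T2) T1)
       (commutator (cadjoint T1) T2) (commutator (cadjoint T2) T2))"

definition normal_operator :: "('a::complex_hilbert_space \<Rightarrow> 'a) \<Rightarrow> bool" where
  "normal_operator N \<longleftrightarrow> bounded_clinear N \<and> cadjoint N \<circ> N = N \<circ> cadjoint N"

text \<open>
  The operator \<open>T\<close> is the restriction of a normal operator on the Hilbert space \<open>'k\<close> to an
  invariant subspace, the space of \<open>T\<close> being identified with a subspace of \<open>'k\<close> by a linear
  isometry \<open>V\<close>.  Quantification over the larger Hilbert space is quantification over the type
  \<open>'k\<close>: a theorem that assumes \<open>subnormal TYPE('k) T\<close> with a free type variable \<open>'k\<close> covers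
  every operator that has a normal extension on some Hilbert space.
\<close>

definition subnormal ::
    "'k::complex_hilbert_space itself \<Rightarrow> ('a::complex_hilbert_space \<Rightarrow> 'a) \<Rightarrow> bool" where
  "subnormal _ T \<longleftrightarrow> bounded_clinear T \<and>
     (\<exists>(V :: 'a \<Rightarrow> 'k) N. bounded_clinear V \<and> (\<forall>x. norm (V x) = norm x) \<and>
        normal_operator N \<and> (\<forall>x. N (V x) = V (T x)))"


section \<open>Weighted shifts\<close>

definition two_variable_weighted_shift ::
    "(nat \<times> nat \<Rightarrow> real) \<Rightarrow> (nat \<times> nat \<Rightarrow> real) \<Rightarrow>
     ((nat \<times> nat) ell2 \<Rightarrow> (nat \<times> nat) ell2) \<Rightarrow> ((nat \<times> nat) ell2 \<Rightarrow> (nat \<times> nat) ell2) \<Rightarrow> bool" where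
  "two_variable_weighted_shift \<alpha> \<beta> T1 T2 \<longleftrightarrow>
     (\<forall>k. 0 < \<alpha> k \<and> 0 < \<beta> k) \<and> bounded (range \<alpha>) \<and> bounded (range \<beta>) \<and>
     bounded_clinear T1 \<and> bounded_clinear T2 \<and>
     (\<forall>k. T1 (ket k) = \<alpha> k *\<^sub>R ket (k + (1, 0))) \<and>
     (\<forall>k. T2 (ket k) = \<beta> k *\<^sub>R ket (k + (0, 1)))"

text \<open>The class \<open>SFC\<close>; the two type arguments carry the normal extensions of \<open>T1\<close> and \<open>T2\<close>.\<close>

definition SFC ::
    "'k1::complex_hilbert_space itself \<Rightarrow> 'k2::complex_hilbert_space itself \<Rightarrow>
     (nat \<times> nat \<Rightarrow> real) \<Rightarrow> (nat \<times> nat \<Rightarrow> real) \<Rightarrow>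
     ((nat \<times> nat) ell2 \<Rightarrow> (nat \<times> nat) ell2) \<Rightarrow> ((nat \<times> nat) ell2 \<Rightarrow> (nat \<times> nat) ell2) \<Rightarrow> bool" where
  "SFC K1 K2 \<alpha> \<beta> T1 T2 \<longleftrightarrow>
     two_variable_weighted_shift \<alpha> \<beta> T1 T2 \<and> T1 \<circ> T2 = T2 \<circ> T1 \<and>
     (\<forall>k1\<ge>1. \<forall>k2\<ge>1. \<alpha> (k1, k2) = 1 \<and> \<beta> (k1, k2) = 1) \<and>
     onorm T1 \<le> 1 \<and> onorm T2 \<le> 1 \<and> subnormal K1 T1 \<and> subnormal K2 T2"

text \<open>
  \<open>\<xi>\<close> is the Berger measure of the weighted shift with weights \<open>\<omega>\<close>.  It is a measure on the real
  line concentrated on a compact subset of the half-line.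
\<close>

definition berger_measure :: "(nat \<Rightarrow> real) \<Rightarrow> real measure \<Rightarrow> bool" where
  "berger_measure \<omega> \<xi> \<longleftrightarrow>
     prob_space \<xi> \<and> sets \<xi> = sets borel \<and>
     (\<exists>K. compact K \<and> K \<subseteq> {0..} \<and> emeasure \<xi> (- K) = 0) \<and>
     (\<forall>k\<ge>1. (\<Prod>i<k. (\<omega> i)\<^sup>2) = (\<integral>t. t ^ k \<partial>\<xi>))"

text \<open>\<open>\<mu> = p \<delta>\<^sub>0 + q \<delta>\<^sub>1 + (1 - (p + q)) \<rho>\<close> with a probability measure \<open>\<rho>\<close> without mass in 0 and 1.\<close>

definition atomic_decomposition ::
    "real measure \<Rightarrow> real \<Rightarrow> real \<Rightarrow> real measure \<Rightarrow> bool" where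
  "atomic_decomposition \<mu> p q \<rho> \<longleftrightarrow>
     0 < p \<and> p < 1 \<and> 0 < q \<and> q < 1 \<and> p + q \<le> 1 \<and>
     prob_space \<rho> \<and> sets \<rho> = sets borel \<and> measure \<rho> ({0} \<union> {1}) = 0 \<and>
     (\<forall>A \<in> sets borel. measure \<mu> A =
        p * measure (return borel 0) A + q * measure (return borel 1) A
        + (1 - (p + q)) * measure \<rho> A)"

end

theory Submission
  imports Defs
begin

text \<open>
  Joint hyponormality of a two-variable weighted shift can be tested one lattice point at a time
  (\<open>six_point_test\<close>): expanding the quadratic form of the commutator matrix in coordinates, a
  coordinate \<open>f\<close> at \<open>k + (1, 0)\<close> only meets the coordinate \<open>g\<close> at \<open>k + (0, 1)\<close>.  The form is
  thus a sum over \<open>k\<close> of binary hermitian forms in independent variables, plus nonnegative terms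
  from the two boundary lines, and it is nonnegative exactly when each of the \<open>2 \<times> 2\<close> matrices is
  positive semidefinite.

  In the class SFC the matrices at interior points vanish.  At a point \<open>(n, 0)\<close> with \<open>n \<ge> 1\<close> the
  matrix is automatically positive (\<open>boundary_determinant_nonneg\<close>).  With \<open>\<gamma>\<^sub>n\<close> the moments of
  \<open>\<xi>\<close> and \<open>b = a y\<^sub>0\<close>, commutativity gives \<open>\<beta>\<^sup>2 = b\<^sup>2 / \<gamma>\<^sub>n\<close> at \<open>(n, 0)\<close>, so contractivity of
  \<open>T2\<close> yields \<open>b\<^sup>2 \<le> \<gamma>\<^sub>n\<close> for all \<open>n \<ge> 1\<close>.  Since \<open>T1\<close> is contractive, \<open>\<xi>\<close> lives on the
  unit interval, and \<open>\<gamma>\<^sub>n\<close> tends to \<open>\<xi>{1}\<close>; hence \<open>b\<^sup>2 \<le> \<xi>{1}\<close> and \<open>\<xi> - b\<^sup>2 \<delta>\<^sub>1\<close> is still a positive measure.  Its moments are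
  \<open>\<gamma>\<^sub>n - b\<^sup>2\<close>, and the Cauchy-Schwarz inequality between three consecutive ones is, up to a
  positive factor, the determinant condition at \<open>(n, 0)\<close>.  The other boundary line is symmetric.

  Only the matrix at the origin remains.  Its upper left entry \<open>x\<^sub>1\<^sup>2 - x\<^sub>0\<^sup>2\<close> is \<open>x\<^sub>0\<^sup>-\<^sup>2\<close> times the
  variance of \<open>\<xi>\<close>, which is positive because \<open>\<xi>\<close> charges \<open>0\<close> and has positive mean
  (\<open>berger_measure_mass_zero_variance\<close>).  So the matrix is positive semidefinite iff
  its determinant is nonnegative, and solving that inequality for \<open>y\<^sub>0\<close> gives the bound \<open>h\<close>.
\<close>

section \<open>Coordinates in the space of square-summable families\<close>

lemma ell2_nth_ket: "ell2_nth (ket k) i = (if i = k then 1 else 0)"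
  by (simp add: ket.rep_eq)

lemma ell2_nth_sum: "ell2_nth (\<Sum>x\<in>A. f x) i = (\<Sum>x\<in>A. ell2_nth (f x) i)"
  by (induction A rule: infinite_finite_induct) (simp_all add: ell2_nth_ops)

lemma infsum_UNIV_single:
  fixes h :: "'i \<Rightarrow> 'b::{comm_monoid_add,t2_space}"
  assumes "\<And>i. i \<noteq> k \<Longrightarrow> h i = 0"
  shows "infsum h UNIV = h k"
proof -
  have "infsum h UNIV = infsum h {k}"
    by (rule infsum_cong_neutral) (use assms in auto)
  thus ?thesis by simp
qed

lemma cinner_ket_right: "cinner f (ket k) = ell2_nth f k"
proof -
  have "cinner f (ket k) = ell2_nth f k * cnj (ell2_nth (ket k) k)"
    unfolding cinner_ell2_def by (rule infsum_UNIV_single) (simp add: ell2_nth_ket)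
  thus ?thesis by (simp add: ell2_nth_ket)
qed

lemma bounded_linear_ell2_nth: "bounded_linear (\<lambda>f. ell2_nth f i)"
  by (rule bounded_linear_intro[where K = 1])
    (simp_all add: ell2_nth_ops scaleR_conv_of_real ell2_nth_le_norm)

lemma norm_ket: "norm (ket k) = 1"
proof -
  have "(norm (ket k))\<^sup>2 = (cmod (ell2_nth (ket k) k))\<^sup>2"
    unfolding ell2_norm_sq by (rule infsum_UNIV_single) (simp add: ell2_nth_ket)
  thus ?thesis by (simp add: ell2_nth_ket power2_eq_1_iff)
      (metis norm_ge_zero not_one_le_zero neg_0_le_iff_le)
qed

text \<open>
  Convergence in norm, which lets a bounded operator be computed from its values on the basis: the
  squared distance to a partial sum is the tail of the series of \<open>(norm f)\<^sup>2\<close>.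
\<close>

lemma ket_expansion: "((\<lambda>k. ell2_nth f k *\<^sub>C ket k) has_sum f) UNIV"
proof -
  have tail: "(norm (f - (\<Sum>k\<in>F. ell2_nth f k *\<^sub>C ket k)))\<^sup>2
      = (norm f)\<^sup>2 - (\<Sum>k\<in>F. (cmod (ell2_nth f k))\<^sup>2)" if "finite F" for F
  proof -
    let ?s = "\<lambda>i. (cmod (ell2_nth f i))\<^sup>2"
    have coord: "ell2_nth (f - (\<Sum>k\<in>F. ell2_nth f k *\<^sub>C ket k)) i
        = (if i \<in> F then 0 else ell2_nth f i)" for i
      using that
      by (simp add: ell2_nth_diff ell2_nth_sum scaleC_ell2.rep_eq ell2_nth_ket if_distrib cong: if_cong)
    have "(norm (f - (\<Sum>k\<in>F. ell2_nth f k *\<^sub>C ket k)))\<^sup>2 = infsum ?s (UNIV - F)"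
      unfolding ell2_norm_sq coord by (rule infsum_cong_neutral) auto
    also have "\<dots> = infsum ?s UNIV - infsum ?s F"
      by (rule infsum_Diff) (use that in \<open>auto intro: ell2_summable\<close>)
    finally show ?thesis using that by (simp add: ell2_norm_sq)
  qed
  have "((\<lambda>F. \<Sum>k\<in>F. (cmod (ell2_nth f k))\<^sup>2) \<longlongrightarrow> (norm f)\<^sup>2) (finite_subsets_at_top UNIV)"
    using has_sum_infsum[OF ell2_summable[of f]] unfolding has_sum_def ell2_norm_sq .
  hence "((\<lambda>F. sqrt ((norm f)\<^sup>2 - (\<Sum>k\<in>F. (cmod (ell2_nth f k))\<^sup>2))) \<longlongrightarrow> sqrt ((norm f)\<^sup>2 - (norm f)\<^sup>2))
      (finite_subsets_at_top UNIV)"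
    by (intro tendsto_intros)
  hence lim: "((\<lambda>F. sqrt ((norm f)\<^sup>2 - (\<Sum>k\<in>F. (cmod (ell2_nth f k))\<^sup>2))) \<longlongrightarrow> 0)
      (finite_subsets_at_top UNIV)"
    by simp
  have "((\<lambda>F. dist (\<Sum>k\<in>F. ell2_nth f k *\<^sub>C ket k) f) \<longlongrightarrow> 0) (finite_subsets_at_top UNIV)"
  proof (rule Lim_transform_eventually[OF lim])
    show "\<forall>\<^sub>F F in finite_subsets_at_top UNIV.
        sqrt ((norm f)\<^sup>2 - (\<Sum>k\<in>F. (cmod (ell2_nth f k))\<^sup>2))
          = dist (\<Sum>k\<in>F. ell2_nth f k *\<^sub>C ket k) f"
      by (rule eventually_finite_subsets_at_top_weakI)
        (simp add: tail[symmetric] dist_norm norm_minus_commute)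
  qed
  thus ?thesis unfolding has_sum_def by (subst tendsto_dist_iff)
qed


section \<open>Weighted shifts along an injection\<close>

text \<open>
  Both coordinates of a two-variable weighted shift have this form, with \<open>s\<close> a unit translation
  of the lattice.
\<close>

definition weighted_shift_along :: "('i \<Rightarrow> 'i) \<Rightarrow> ('i \<Rightarrow> real) \<Rightarrow> ('i ell2 \<Rightarrow> 'i ell2) \<Rightarrow> bool" where
  "weighted_shift_along s \<omega> T \<longleftrightarrow> inj s \<and> bounded (range \<omega>) \<and> bounded_clinear T \<and>
     (\<forall>k. T (ket k) = \<omega> k *\<^sub>R ket (s k))"

lemma weighted_shift_nth:
  assumes "weighted_shift_along s \<omega> T"
  shows "ell2_nth (T f) (s k) = of_real (\<omega> k) * ell2_nth f k"
    and "m \<notin> range s \<Longrightarrow> ell2_nth (T f) m = 0"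
proof -
  have lin: "bounded_linear T" and scale: "\<And>c x. T (c *\<^sub>C x) = c *\<^sub>C T x"
    and ket: "\<And>k. T (ket k) = \<omega> k *\<^sub>R ket (s k)" and inj: "inj s"
    using assms by (auto simp: weighted_shift_along_def bounded_clinear_def)
  have image_coord: "ell2_nth (T (ell2_nth f j *\<^sub>C ket j)) m
      = (if m = s j then of_real (\<omega> j) * ell2_nth f j else 0)" for j m
    by (simp add: scale ket scaleC_ell2.rep_eq ell2_nth_ops ell2_nth_ket)
  have expand: "ell2_nth (T f) m = (\<Sum>\<^sub>\<infinity>j. if m = s j then of_real (\<omega> j) * ell2_nth f j else 0)" for m
    using has_sum_bounded_linear[OF bounded_linear_compose[OF bounded_linear_ell2_nth lin]
        ket_expansion[of f], of m]
    by (simp add: o_def image_coord infsumI)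
  show "ell2_nth (T f) (s k) = of_real (\<omega> k) * ell2_nth f k"
    unfolding expand
    by (subst infsum_UNIV_single[of k]) (use inj in \<open>auto simp: inj_eq\<close>)
  show "ell2_nth (T f) m = 0" if "m \<notin> range s"
    unfolding expand by (rule infsum_0) (use that in auto)
qed

lemma backward_shift_square_summable:
  assumes "inj s" "bounded (range \<omega>)"
  shows "(\<lambda>k. (cmod (of_real (\<omega> k) * ell2_nth f (s k)))\<^sup>2) summable_on UNIV"
proof -
  obtain B where B: "\<And>k. \<bar>\<omega> k\<bar> \<le> B"
    using assms(2) by (auto simp: bounded_iff)
  have "(\<lambda>k. (cmod (ell2_nth f k))\<^sup>2) summable_on range s"
    by (rule summable_on_subset_banach[OF ell2_summable]) simp
  hence "((\<lambda>k. (cmod (ell2_nth f k))\<^sup>2) \<circ> s) summable_on UNIV"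
    using summable_on_reindex[OF assms(1), of "\<lambda>k. (cmod (ell2_nth f k))\<^sup>2"] by simp
  hence "(\<lambda>k. B\<^sup>2 * (cmod (ell2_nth f (s k)))\<^sup>2) summable_on UNIV"
    by (intro summable_on_cmult_right) (simp add: o_def)
  thus ?thesis
    by (rule summable_on_comparison_test)
      (auto simp: norm_mult power_mult_distrib intro!: mult_right_mono abs_le_square_iff[THEN iffD1, of _ B, simplified] order.trans[OF B])
qed

lemma cinner_shift_right:
  assumes "weighted_shift_along s \<omega> T"
  shows "cinner f (T g) = (\<Sum>\<^sub>\<infinity>k. (of_real (\<omega> k) * ell2_nth f (s k)) * cnj (ell2_nth g k))"
proof -
  have inj: "inj s" using assms by (simp add: weighted_shift_along_def)
  have "cinner f (T g) = (\<Sum>\<^sub>\<infinity>m\<in>range s. ell2_nth f m * cnj (ell2_nth (T g) m))"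
    unfolding cinner_ell2_def
    by (rule infsum_cong_neutral) (auto simp: weighted_shift_nth(2)[OF assms])
  also have "\<dots> = (\<Sum>\<^sub>\<infinity>k. ell2_nth f (s k) * cnj (ell2_nth (T g) (s k)))"
    using infsum_reindex[OF inj, of "\<lambda>m. ell2_nth f m * cnj (ell2_nth (T g) m)"]
    by (simp add: o_def)
  finally show ?thesis
    by (simp add: weighted_shift_nth(1)[OF assms] mult_ac)
qed

text \<open>
  The adjoint is defined by choice, so an operator with the adjoint property has to be exhibited:
  it is the weighted backward shift.  Pairing with basis vectors then determines the coordinates.
\<close>

lemma
  assumes "weighted_shift_along s \<omega> T"
  shows cinner_cadjoint_shift: "cinner (cadjoint T f) g = cinner f (T g)"
    and cadjoint_shift_nth: "ell2_nth (cadjoint T f) k = of_real (\<omega> k) * ell2_nth f (s k)"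
proof -
  define S where "S f = Abs_ell2 (\<lambda>k. of_real (\<omega> k) * ell2_nth f (s k))" for f
  have S: "ell2_nth (S f) = (\<lambda>k. of_real (\<omega> k) * ell2_nth f (s k))" for f
    unfolding S_def
    by (rule Abs_ell2_inverse)
      (use assms backward_shift_square_summable in \<open>auto simp: weighted_shift_along_def\<close>)
  have "\<exists>S. \<forall>f g. cinner (S f) g = cinner f (T g)"
    by (rule exI[of _ S]) (simp add: cinner_shift_right[OF assms], simp add: cinner_ell2_def S)
  hence adj: "cinner (cadjoint T f) g = cinner f (T g)" for f g
    using someI_ex[of "\<lambda>S. \<forall>f g. cinner (S f) g = cinner f (T g)"] unfolding cadjoint_def by blast
  thus "cinner (cadjoint T f) g = cinner f (T g)" .
  have "ell2_nth (cadjoint T f) k = cinner f (T (ket k))"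
    by (simp add: adj flip: cinner_ket_right)
  also have "\<dots> = of_real (\<omega> k) * ell2_nth f (s k) * cnj (ell2_nth (ket k) k)"
    unfolding cinner_shift_right[OF assms]
    by (rule infsum_UNIV_single) (simp add: ell2_nth_ket)
  finally show "ell2_nth (cadjoint T f) k = of_real (\<omega> k) * ell2_nth f (s k)"
    by (simp add: ell2_nth_ket)
qed

lemma cinner_shift_left:
  assumes "weighted_shift_along s \<omega> T"
  shows "cinner (T f) g = cinner f (cadjoint T g)"
  by (metis assms cinner_cadjoint_shift cinner_commute)

lemma norm_shift_sq:
  assumes "weighted_shift_along s \<omega> T"
  shows "((\<lambda>k. (\<omega> k)\<^sup>2 * (cmod (ell2_nth f k))\<^sup>2) has_sum (norm (T f))\<^sup>2) UNIV"
proof -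
  let ?h = "\<lambda>m. (cmod (ell2_nth (T f) m))\<^sup>2"
  have inj: "inj s" using assms by (simp add: weighted_shift_along_def)
  have "(?h has_sum (norm (T f))\<^sup>2) UNIV"
    unfolding ell2_norm_sq by (rule has_sum_infsum[OF ell2_summable])
  hence "(?h has_sum (norm (T f))\<^sup>2) (range s)"
    by (subst has_sum_cong_neutral[of "UNIV" "range s" ?h ?h])
      (auto simp: weighted_shift_nth(2)[OF assms])
  thus ?thesis
    unfolding has_sum_reindex[OF inj]
    by (simp add: o_def weighted_shift_nth(1)[OF assms] norm_mult power_mult_distrib)
qed

text \<open>
  Reindexed by \<open>s\<close>, the series of \<open>(norm (T f))\<^sup>2\<close> involves the coordinates \<open>f (s k)\<close> that also
  occur in the adjoint; the indices outside the range of \<open>s\<close> are the boundary terms.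
\<close>

lemma norm_shift_sq_split:
  assumes "weighted_shift_along s \<omega> T"
  shows "((\<lambda>k. (\<omega> (s k))\<^sup>2 * (cmod (ell2_nth f (s k)))\<^sup>2) has_sum
      (norm (T f))\<^sup>2 - (\<Sum>\<^sub>\<infinity>k\<in>- range s. (\<omega> k)\<^sup>2 * (cmod (ell2_nth f k))\<^sup>2)) UNIV"
proof -
  let ?h = "\<lambda>k. (\<omega> k)\<^sup>2 * (cmod (ell2_nth f k))\<^sup>2"
  have inj: "inj s" using assms by (simp add: weighted_shift_along_def)
  note total = norm_shift_sq[OF assms, of f]
  have "?h summable_on - range s"
    by (rule summable_on_subset_banach[OF has_sum_imp_summable[OF total]]) simp
  hence "(?h has_sum (norm (T f))\<^sup>2 - infsum ?h (- range s)) (UNIV - - range s)"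
    by (intro has_sum_Diff[OF total] has_sum_infsum) auto
  thus ?thesis
    unfolding Diff_eq double_complement Int_UNIV_left has_sum_reindex[OF inj] by (simp add: o_def)
qed


section \<open>Joint hyponormality of a pair of weighted shifts\<close>

lemma cinner_self: "cinner x x = of_real ((norm x)\<^sup>2)"
  using cinner_commute[of x x]
  by (auto simp: complex_eq_iff Re_cinner power2_norm_eq_inner)

lemma cinner_add_right: "cinner x (y + z) = cinner x y + cinner x z"
  by (metis cinner_commute cinner_add_left complex_cnj_add)

lemma cinner_diff_left: "cinner (x - y) z = cinner x z - cinner y z"
  using cinner_add_left[of "x - y" y z] by simp

text \<open>
  Moving adjoints across the inner product, the positive part of the form of the commutator matrix
  at \<open>(f, g)\<close> consists of two squared norms and a cross term, while the negative part is a perfect square.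
\<close>

lemma jointly_hyponormal_shifts_iff:
  assumes T1: "weighted_shift_along s1 \<alpha> T1" and T2: "weighted_shift_along s2 \<beta> T2"
  shows "jointly_hyponormal T1 T2 \<longleftrightarrow> (\<forall>f g.
    (norm (cadjoint T1 f + cadjoint T2 g))\<^sup>2
      \<le> (norm (T1 f))\<^sup>2 + (norm (T2 g))\<^sup>2 + 2 * Re (cinner (T2 f) (T1 g)))"
proof -
  have *: "cinner (operator_matrix
       (commutator (cadjoint T1) T1) (commutator (cadjoint T2) T1)
       (commutator (cadjoint T1) T2) (commutator (cadjoint T2) T2) (f, g)) (f, g)
    = of_real ((norm (T1 f))\<^sup>2 + (norm (T2 g))\<^sup>2 + 2 * Re (cinner (T2 f) (T1 g))
        - (norm (cadjoint T1 f + cadjoint T2 g))\<^sup>2)" for f g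
  proof -
    have cross: "of_real (2 * Re (cinner (T2 f) (T1 g))) = cinner (T2 f) (T1 g) + cinner (T1 g) (T2 f)"
      by (subst (3) cinner_commute) (simp add: complex_add_cnj)
    show ?thesis
      unfolding of_real_diff of_real_add cross cinner_self[symmetric] operator_matrix_def
        commutator_def cinner_prod_def
      by (simp add: cinner_add_left cinner_add_right cinner_diff_left
          cinner_cadjoint_shift[OF T1] cinner_cadjoint_shift[OF T2]
          cinner_shift_left[OF T1] cinner_shift_left[OF T2])
  qed
  show ?thesis
    unfolding jointly_hyponormal_def positive_operator_def split_paired_All *
    unfolding nonneg_Reals_of_real_iff diff_ge_0_iff_ge by (rule refl)
qed

definition hermitian_form :: "real \<Rightarrow> real \<Rightarrow> real \<Rightarrow> complex \<Rightarrow> complex \<Rightarrow> real" where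
  "hermitian_form A c D u v = A * (cmod u)\<^sup>2 + 2 * c * Re (u * cnj v) + D * (cmod v)\<^sup>2"

text \<open>
  At the vectors \<open>(- c, A)\<close> and \<open>(D, - c)\<close> the form equals its determinant times \<open>A\<close> and \<open>D\<close>
  respectively, so one of them decides the sign of the determinant unless both diagonal entries
  vanish.
\<close>

lemma real_form_nonnegD:
  fixes A c D :: real
  assumes "\<And>r t. 0 \<le> A * r\<^sup>2 + 2 * c * r * t + D * t\<^sup>2"
  shows "0 \<le> A \<and> 0 \<le> D \<and> c\<^sup>2 \<le> A * D"
proof -
  have A: "0 \<le> A" using assms[of 1 0] by simp
  have D: "0 \<le> D" using assms[of 0 1] by simp
  have "c\<^sup>2 \<le> A * D"
  proof (cases "A = 0 \<and> D = 0")
    case True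
    thus ?thesis using assms[of 1 "- c"] by (simp add: power2_eq_square)
  next
    case False
    have "0 \<le> A * (A * D - c\<^sup>2)" "0 \<le> D * (A * D - c\<^sup>2)"
      using assms[of "- c" A] assms[of D "- c"] by (simp_all add: algebra_simps power2_eq_square)
    thus ?thesis using False A D by (auto simp: zero_le_mult_iff)
  qed
  thus ?thesis using A D by simp
qed

lemma hermitian_form_nonneg_iff:
  "(\<forall>u v. 0 \<le> hermitian_form A c D u v) \<longleftrightarrow> 0 \<le> A \<and> 0 \<le> D \<and> c\<^sup>2 \<le> A * D"
proof
  assume form: "\<forall>u v. 0 \<le> hermitian_form A c D u v"
  have "0 \<le> A * r\<^sup>2 + 2 * c * r * t + D * t\<^sup>2" for r t
    using form[rule_format, of "of_real r" "of_real t"] by (simp add: hermitian_form_def mult.assoc)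
  thus "0 \<le> A \<and> 0 \<le> D \<and> c\<^sup>2 \<le> A * D" by (rule real_form_nonnegD)
next
  assume psd: "0 \<le> A \<and> 0 \<le> D \<and> c\<^sup>2 \<le> A * D"
  have "0 \<le> hermitian_form A c D u v" for u v
  proof -
    have "\<bar>c\<bar> \<le> sqrt A * sqrt D"
      using psd real_le_rsqrt[of "\<bar>c\<bar>" "A * D"] by (simp add: real_sqrt_mult)
    hence "\<bar>c\<bar> * \<bar>Re (u * cnj v)\<bar> \<le> (sqrt A * sqrt D) * (cmod u * cmod v)"
      using abs_Re_le_cmod[of "u * cnj v"] psd by (intro mult_mono) (simp_all add: norm_mult)
    hence "- (c * Re (u * cnj v)) \<le> (sqrt A * cmod u) * (sqrt D * cmod v)"
      by (simp add: abs_mult[symmetric] mult_ac)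
    moreover have "2 * ((sqrt A * cmod u) * (sqrt D * cmod v)) \<le> A * (cmod u)\<^sup>2 + D * (cmod v)\<^sup>2"
      using sum_squares_bound[of "sqrt A * cmod u" "sqrt D * cmod v"] psd
      by (simp add: power_mult_distrib mult_ac)
    ultimately show ?thesis
      unfolding hermitian_form_def by linarith
  qed
  thus "\<forall>u v. 0 \<le> hermitian_form A c D u v" by blast
qed

text \<open>
  The second assumption on \<open>s1\<close> and \<open>s2\<close> makes the commuting square cartesian: \<open>T2 f\<close> and \<open>T1 g\<close>
  only overlap on the range of \<open>s1 \<circ> s2\<close>, so that the cross term, like everything else, is indexed
  by \<open>k\<close> and pairs \<open>f (s1 k)\<close> with \<open>g (s2 k)\<close>.  The two subtracted sums are the boundary terms.
\<close>

lemma hyponormality_defect_sum: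
  assumes T1: "weighted_shift_along s1 \<alpha> T1" and T2: "weighted_shift_along s2 \<beta> T2"
    and square: "\<And>k. s1 (s2 k) = s2 (s1 k)" "range s1 \<inter> range s2 \<subseteq> range (\<lambda>k. s1 (s2 k))"
  shows "((\<lambda>k. hermitian_form ((\<alpha> (s1 k))\<^sup>2 - (\<alpha> k)\<^sup>2) (\<alpha> (s2 k) * \<beta> (s1 k) - \<alpha> k * \<beta> k)
        ((\<beta> (s2 k))\<^sup>2 - (\<beta> k)\<^sup>2) (ell2_nth f (s1 k)) (ell2_nth g (s2 k))) has_sum
      (norm (T1 f))\<^sup>2 + (norm (T2 g))\<^sup>2 + 2 * Re (cinner (T2 f) (T1 g))
        - (norm (cadjoint T1 f + cadjoint T2 g))\<^sup>2
        - (\<Sum>\<^sub>\<infinity>k\<in>- range s1. (\<alpha> k)\<^sup>2 * (cmod (ell2_nth f k))\<^sup>2)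
        - (\<Sum>\<^sub>\<infinity>k\<in>- range s2. (\<beta> k)\<^sup>2 * (cmod (ell2_nth g k))\<^sup>2)) UNIV"
proof -
  have inj: "inj s1" "inj s2" using T1 T2 by (simp_all add: weighted_shift_along_def)
  hence inj12: "inj (\<lambda>k. s1 (s2 k))" using inj_compose[of s1 s2] by (simp add: o_def)
  have cmod_sum_sq: "(cmod (of_real r * z + of_real t * w))\<^sup>2
      = r\<^sup>2 * (cmod z)\<^sup>2 + 2 * (r * t * Re (z * cnj w)) + t\<^sup>2 * (cmod w)\<^sup>2" for r t z w
    unfolding cmod_power2 by (simp add: power2_eq_square algebra_simps)
  have Re_of_real_mult: "Re (of_real r * z) = r * Re z" for r z by simp
  let ?f = "\<lambda>k. ell2_nth f (s1 k)" and ?g = "\<lambda>k. ell2_nth g (s2 k)"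
  let ?h = "\<lambda>m. ell2_nth (T2 f) m * cnj (ell2_nth (T1 g) m)"
  have "(?h has_sum cinner (T2 f) (T1 g)) UNIV"
    unfolding cinner_ell2_def by (rule has_sum_infsum[OF ell2_product_summable])
  moreover have "?h m = 0" if "m \<notin> range (\<lambda>k. s1 (s2 k))" for m
  proof -
    have "m \<notin> range s1 \<or> m \<notin> range s2" using that square(2) by blast
    thus ?thesis
      using weighted_shift_nth(2)[OF T1, of m g] weighted_shift_nth(2)[OF T2, of m f] by auto
  qed
  ultimately have "(?h has_sum cinner (T2 f) (T1 g)) (range (\<lambda>k. s1 (s2 k)))"
    by (subst has_sum_cong_neutral[of UNIV _ ?h ?h]) auto
  moreover have "?h (s1 (s2 k)) = of_real (\<alpha> (s2 k) * \<beta> (s1 k)) * (?f k * cnj (?g k))" for k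
    using weighted_shift_nth(1)[OF T1, of g "s2 k"] weighted_shift_nth(1)[OF T2, of f "s1 k"]
    by (simp add: square(1))
  ultimately have "((\<lambda>k. of_real (\<alpha> (s2 k) * \<beta> (s1 k)) * (?f k * cnj (?g k)))
      has_sum cinner (T2 f) (T1 g)) UNIV"
    unfolding has_sum_reindex[OF inj12] by (simp add: o_def)
  hence "((\<lambda>k. Re (of_real (\<alpha> (s2 k) * \<beta> (s1 k)) * (?f k * cnj (?g k))))
      has_sum Re (cinner (T2 f) (T1 g))) UNIV"
    by (rule has_sum_Re)
  hence cross: "((\<lambda>k. 2 * (\<alpha> (s2 k) * \<beta> (s1 k) * Re (?f k * cnj (?g k))))
      has_sum 2 * Re (cinner (T2 f) (T1 g))) UNIV"
    by (intro has_sum_cmult_right) (simp only: Re_of_real_mult)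
  have "((\<lambda>k. (cmod (ell2_nth (cadjoint T1 f + cadjoint T2 g) k))\<^sup>2)
      has_sum (norm (cadjoint T1 f + cadjoint T2 g))\<^sup>2) UNIV"
    unfolding ell2_norm_sq by (rule has_sum_infsum[OF ell2_summable])
  hence adj: "((\<lambda>k. (\<alpha> k)\<^sup>2 * (cmod (?f k))\<^sup>2 + 2 * (\<alpha> k * \<beta> k * Re (?f k * cnj (?g k)))
        + (\<beta> k)\<^sup>2 * (cmod (?g k))\<^sup>2)
      has_sum (norm (cadjoint T1 f + cadjoint T2 g))\<^sup>2) UNIV"
    by (simp only: plus_ell2.rep_eq cadjoint_shift_nth[OF T1] cadjoint_shift_nth[OF T2] cmod_sum_sq)
  show ?thesis
    using has_sum_add[OF has_sum_add[OF has_sum_add[OF norm_shift_sq_split[OF T1, of f]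
          norm_shift_sq_split[OF T2, of g]] cross] has_sum_uminusI[OF adj]]
    by (simp add: hermitian_form_def algebra_simps)
qed

text \<open>
  For sufficiency, the summands and the boundary terms are all nonnegative.  For necessity at \<open>k\<close>,
  test vectors supported at \<open>s1 k\<close> and \<open>s2 k\<close> isolate the form at \<open>k\<close>, since both maps are
  injective, and they do not meet the boundary.  For translations of the
  lattice, the weights involved join the six points of a triangle with vertex \<open>k\<close>, whence the name.
\<close>

theorem six_point_test:
  assumes T1: "weighted_shift_along s1 \<alpha> T1" and T2: "weighted_shift_along s2 \<beta> T2"
    and square: "\<And>k. s1 (s2 k) = s2 (s1 k)" "range s1 \<inter> range s2 \<subseteq> range (\<lambda>k. s1 (s2 k))"
  shows "jointly_hyponormal T1 T2 \<longleftrightarrow> (\<forall>k. (\<alpha> k)\<^sup>2 \<le> (\<alpha> (s1 k))\<^sup>2 \<and> (\<beta> k)\<^sup>2 \<le> (\<beta> (s2 k))\<^sup>2 \<and>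
    (\<alpha> (s2 k) * \<beta> (s1 k) - \<alpha> k * \<beta> k)\<^sup>2
      \<le> ((\<alpha> (s1 k))\<^sup>2 - (\<alpha> k)\<^sup>2) * ((\<beta> (s2 k))\<^sup>2 - (\<beta> k)\<^sup>2))"
proof -
  have inj: "inj s1" "inj s2" using T1 T2 by (simp_all add: weighted_shift_along_def)
  define Q where "Q k = hermitian_form ((\<alpha> (s1 k))\<^sup>2 - (\<alpha> k)\<^sup>2)
    (\<alpha> (s2 k) * \<beta> (s1 k) - \<alpha> k * \<beta> k) ((\<beta> (s2 k))\<^sup>2 - (\<beta> k)\<^sup>2)" for k
  let ?b1 = "\<lambda>f. \<Sum>\<^sub>\<infinity>k\<in>- range s1. (\<alpha> k)\<^sup>2 * (cmod (ell2_nth f k))\<^sup>2"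
    and ?b2 = "\<lambda>g. \<Sum>\<^sub>\<infinity>k\<in>- range s2. (\<beta> k)\<^sup>2 * (cmod (ell2_nth g k))\<^sup>2"
  have hyp: "jointly_hyponormal T1 T2 \<longleftrightarrow>
      (\<forall>f g. 0 \<le> (\<Sum>\<^sub>\<infinity>k. Q k (ell2_nth f (s1 k)) (ell2_nth g (s2 k))) + ?b1 f + ?b2 g)"
    unfolding jointly_hyponormal_shifts_iff[OF T1 T2] Q_def
      infsumI[OF hyponormality_defect_sum[OF T1 T2 square]]
    by (simp add: algebra_simps)
  have "jointly_hyponormal T1 T2 \<longleftrightarrow> (\<forall>k u v. 0 \<le> Q k u v)"
  proof
    assume "\<forall>k u v. 0 \<le> Q k u v"
    thus "jointly_hyponormal T1 T2"
      unfolding hyp by (intro allI add_nonneg_nonneg infsum_nonneg) auto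
  next
    assume hn: "jointly_hyponormal T1 T2"
    show "\<forall>k u v. 0 \<le> Q k u v"
    proof (intro allI)
      fix k u v
      let ?f = "u *\<^sub>C ket (s1 k)" and ?g = "v *\<^sub>C ket (s2 k)"
      have "?b1 ?f = 0" "?b2 ?g = 0"
        by (rule infsum_0; auto simp: scaleC_ell2.rep_eq ell2_nth_ket)+
      moreover have "(\<Sum>\<^sub>\<infinity>j. Q j (ell2_nth ?f (s1 j)) (ell2_nth ?g (s2 j))) = Q k u v"
        by (subst infsum_UNIV_single[of k])
          (use inj in \<open>auto simp: scaleC_ell2.rep_eq ell2_nth_ket Q_def hermitian_form_def inj_eq\<close>)
      ultimately show "0 \<le> Q k u v"
        using hn[unfolded hyp, rule_format, of ?f ?g] by simp
    qed
  qed
  thus ?thesis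
    unfolding Q_def hermitian_form_nonneg_iff by simp
qed


section \<open>Moments of the Berger measure\<close>

lemma point_mass_le_integral:
  fixes \<phi> :: "real \<Rightarrow> real"
  assumes "finite_measure M" "sets M = sets borel" "integrable M \<phi>" "AE t in M. 0 \<le> \<phi> t"
  shows "measure M {r} * \<phi> r \<le> (\<integral>t. \<phi> t \<partial>M)"
proof -
  interpret finite_measure M by fact
  have "(\<integral>t. indicator {r} t * \<phi> r \<partial>M) \<le> (\<integral>t. \<phi> t \<partial>M)"
  proof (rule integral_mono_AE)
    show "integrable M (\<lambda>t. indicator {r} t * \<phi> r)"
      using assms(2) by (auto simp: emeasure_eq_measure)
    show "AE t in M. indicator {r} t * \<phi> r \<le> \<phi> t"
      using assms(4) by eventually_elim (auto simp: indicator_def)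
  qed (use assms in auto)
  moreover have "{r} \<inter> space M = {r}"
    using sets_eq_imp_space_eq[OF assms(2)] by simp
  ultimately show ?thesis by simp
qed

lemma berger_measure_AE_compact:
  assumes "berger_measure \<omega> \<xi>"
  obtains K where "compact K" "K \<subseteq> {0..}" "AE t in \<xi>. t \<in> K"
proof -
  obtain K where K: "compact K" "K \<subseteq> {0..}" "emeasure \<xi> (- K) = 0" and sets: "sets \<xi> = sets borel"
    using assms by (auto simp: berger_measure_def)
  have "- K \<in> sets \<xi>"
    unfolding sets by (intro borel_comp borel_closed compact_imp_closed K)
  hence "AE t in \<xi>. t \<in> K"
    by (intro AE_I[of _ _ "- K"]) (use K in auto)
  thus ?thesis using that K by blast
qed

lemma berger_measure_AE_nonneg:
  assumes "berger_measure \<omega> \<xi>"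
  shows "AE t in \<xi>. 0 \<le> t"
proof -
  obtain K where "K \<subseteq> {0..}" "AE t in \<xi>. t \<in> K"
    using berger_measure_AE_compact[OF assms] .
  thus ?thesis by (auto elim: eventually_mono)
qed

lemma berger_measure_integrable_power:
  assumes "berger_measure \<omega> \<xi>"
  shows "integrable \<xi> (\<lambda>t. t ^ n)"
proof -
  have sets: "sets \<xi> = sets borel" and "prob_space \<xi>"
    using assms by (auto simp: berger_measure_def)
  interpret prob_space \<xi> by fact
  obtain K where K: "compact K" and AE: "AE t in \<xi>. t \<in> K"
    using berger_measure_AE_compact[OF assms] .
  obtain B where B: "\<And>t. t \<in> K \<Longrightarrow> \<bar>t\<bar> \<le> B"
    using compact_imp_bounded[OF K] by (auto simp: bounded_iff)
  have "AE t in \<xi>. norm (t ^ n) \<le> B ^ n"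
    using AE by eventually_elim (auto simp: power_abs intro!: power_mono B)
  moreover have "(\<lambda>t. t ^ n) \<in> borel_measurable \<xi>"
    by (simp add: measurable_cong_sets[OF sets refl])
  ultimately show ?thesis by (rule integrable_const_bound)
qed

lemma berger_measure_moment:
  assumes "berger_measure \<omega> \<xi>"
  shows "(\<integral>t. t ^ n \<partial>\<xi>) = (\<Prod>i<n. (\<omega> i)\<^sup>2)"
proof (cases "n = 0")
  case True
  have "prob_space \<xi>" using assms by (simp add: berger_measure_def)
  thus ?thesis using True by (simp add: prob_space.prob_space)
next
  case False
  thus ?thesis using assms unfolding berger_measure_def by (simp add: Suc_le_eq)
qed

text \<open>
  Mass beyond \<open>1 + e\<close> would make the moments grow like \<open>(1 + e) ^ n\<close>, but they are products of
  numbers at most one.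
\<close>

lemma berger_measure_AE_le_one:
  assumes \<xi>: "berger_measure \<omega> \<xi>" and \<omega>: "\<And>i. \<bar>\<omega> i\<bar> \<le> 1"
  shows "AE t in \<xi>. t \<le> 1"
proof -
  have sets: "sets \<xi> = sets borel" and "prob_space \<xi>"
    using \<xi> by (auto simp: berger_measure_def)
  interpret prob_space \<xi> by fact
  have null: "measure \<xi> {1 + e..} = 0" if "0 < e" for e :: real
  proof (rule ccontr)
    assume "measure \<xi> {1 + e..} \<noteq> 0"
    hence pos: "0 < measure \<xi> {1 + e..}" by (simp add: zero_less_measure_iff)
    have bound: "(1 + e) ^ n * measure \<xi> {1 + e..} \<le> 1" for n
    proof -
      have "(1 + e) ^ n * measure \<xi> {1 + e..} = (\<integral>t. (1 + e) ^ n * indicator {1 + e..} t \<partial>\<xi>)"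
        using sets_eq_imp_space_eq[OF sets] by simp
      also have "\<dots> \<le> (\<integral>t. t ^ n \<partial>\<xi>)"
      proof (rule integral_mono_AE)
        show "integrable \<xi> (\<lambda>t. (1 + e) ^ n * indicator {1 + e..} t)"
          using sets by (auto simp: emeasure_eq_measure)
        show "AE t in \<xi>. (1 + e) ^ n * indicator {1 + e..} t \<le> t ^ n"
          using berger_measure_AE_nonneg[OF \<xi>]
          by eventually_elim (use \<open>0 < e\<close> in \<open>auto simp: indicator_def intro!: power_mono\<close>)
      qed (rule berger_measure_integrable_power[OF \<xi>])
      also have "\<dots> \<le> 1"
        unfolding berger_measure_moment[OF \<xi>]
        by (rule prod_le_1) (use \<omega> in \<open>auto simp: abs_square_le_1\<close>)
      finally show ?thesis .
    qed
    obtain n where "1 / measure \<xi> {1 + e..} < (1 + e) ^ n"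
      using real_arch_pow[of "1 + e"] \<open>0 < e\<close> by auto
    thus False using bound[of n] pos by (simp add: field_simps)
  qed
  have "AE t in \<xi>. \<forall>m::nat. t < 1 + 1 / Suc m"
    unfolding AE_all_countable
  proof
    fix m :: nat
    show "AE t in \<xi>. t < 1 + 1 / Suc m"
      by (rule AE_I[of _ _ "{1 + 1 / Suc m..}"])
        (use null[of "1 / Suc m"] sets in \<open>auto simp: emeasure_eq_measure not_less\<close>)
  qed
  thus ?thesis
  proof eventually_elim
    fix t :: real
    assume t: "\<forall>m::nat. t < 1 + 1 / Suc m"
    show "t \<le> 1"
    proof (rule ccontr)
      assume "\<not> t \<le> 1"
      then obtain m :: nat where "1 / Suc m < t - 1"
        using reals_Archimedean[of "t - 1"] by (auto simp: inverse_eq_divide)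
      thus False using t[rule_format, of m] by simp
    qed
  qed
qed

text \<open>On the unit interval the powers \<open>t ^ n\<close> decrease to the indicator function of \<open>{1}\<close>.\<close>

lemma berger_measure_moments_tendsto_mass_one:
  assumes \<xi>: "berger_measure \<omega> \<xi>" and \<omega>: "\<And>i. \<bar>\<omega> i\<bar> \<le> 1"
  shows "(\<lambda>n. \<integral>t. t ^ n \<partial>\<xi>) \<longlonglongrightarrow> measure \<xi> {1}"
proof -
  have sets: "sets \<xi> = sets borel" and "prob_space \<xi>"
    using \<xi> by (auto simp: berger_measure_def)
  interpret prob_space \<xi> by fact
  have "(\<lambda>n. \<integral>t. t ^ n \<partial>\<xi>) \<longlonglongrightarrow> (\<integral>t. indicator {1} t \<partial>\<xi>)"
  proof (rule integral_dominated_convergence[where w = "\<lambda>_. 1"])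
    show "AE t in \<xi>. (\<lambda>n. t ^ n) \<longlonglongrightarrow> indicator {1} t"
      using berger_measure_AE_nonneg[OF \<xi>] berger_measure_AE_le_one[OF \<xi> \<omega>]
      by eventually_elim (auto simp: indicator_def intro!: LIMSEQ_power_zero)
    show "AE t in \<xi>. norm (t ^ n) \<le> 1" for n
      using berger_measure_AE_nonneg[OF \<xi>] berger_measure_AE_le_one[OF \<xi> \<omega>]
      by eventually_elim (auto simp: power_abs intro: power_le_one)
  qed (use sets in \<open>auto simp: measurable_cong_sets[OF sets refl]\<close>)
  thus ?thesis
    using sets_eq_imp_space_eq[OF sets] by simp
qed

text \<open>
  This is the Cauchy-Schwarz inequality for the positive measure \<open>\<xi> - c \<delta>\<^sub>1\<close>, whose moments are
  \<open>\<gamma> n - c\<close>.  The difference of measures is avoided by bounding the integral of the square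
  \<open>t ^ n * (r - s * t)\<^sup>2\<close> from below by its value at the atom.
\<close>

lemma berger_measure_moment_log_convex:
  fixes \<xi> :: "real measure"
  assumes \<xi>: "berger_measure \<omega> \<xi>" and c: "c \<le> measure \<xi> {1}"
  defines "\<gamma> \<equiv> \<lambda>n. \<integral>t. t ^ n \<partial>\<xi>"
  shows "(\<gamma> (Suc n) - c)\<^sup>2 \<le> (\<gamma> n - c) * (\<gamma> (Suc (Suc n)) - c)"
proof -
  have sets: "sets \<xi> = sets borel" and "prob_space \<xi>"
    using \<xi> by (auto simp: berger_measure_def)
  interpret prob_space \<xi> by fact
  note int = berger_measure_integrable_power[OF \<xi>]
  have "0 \<le> (\<gamma> n - c) * r\<^sup>2 + 2 * (- (\<gamma> (Suc n) - c)) * r * s + (\<gamma> (Suc (Suc n)) - c) * s\<^sup>2" for r s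
  proof -
    have expand: "t ^ n * (r - s * t)\<^sup>2
        = r\<^sup>2 * t ^ n - 2 * r * s * t ^ Suc n + s\<^sup>2 * t ^ Suc (Suc n)" for t
      by (simp add: power2_eq_square algebra_simps)
    have "c * (r - s)\<^sup>2 \<le> measure \<xi> {1} * (1 ^ n * (r - s * 1)\<^sup>2)"
      using c by (simp add: mult_right_mono)
    also have "\<dots> \<le> (\<integral>t. t ^ n * (r - s * t)\<^sup>2 \<partial>\<xi>)"
    proof (rule point_mass_le_integral)
      show "integrable \<xi> (\<lambda>t. t ^ n * (r - s * t)\<^sup>2)"
        unfolding expand by (intro Bochner_Integration.integrable_add
            Bochner_Integration.integrable_diff integrable_mult_right int)
      show "AE t in \<xi>. 0 \<le> t ^ n * (r - s * t)\<^sup>2"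
        using berger_measure_AE_nonneg[OF \<xi>] by eventually_elim simp
    qed (use sets in \<open>auto intro: finite_measure_axioms\<close>)
    also have "\<dots> = r\<^sup>2 * \<gamma> n - 2 * r * s * \<gamma> (Suc n) + s\<^sup>2 * \<gamma> (Suc (Suc n))"
      unfolding expand \<gamma>_def
      by (simp add: int[of "Suc n"] int[of "Suc (Suc n)"] int del: power_Suc)
    finally show ?thesis by (simp add: power2_eq_square algebra_simps)
  qed
  from real_form_nonnegD[OF this] show ?thesis unfolding power2_minus by blast
qed

text \<open>
  The right-hand side is the variance of \<open>\<xi>\<close>, and \<open>(\<omega> 0)\<^sup>2\<close> is its mean: an atom at \<open>0\<close> alone
  contributes the left-hand side.
\<close>

lemma berger_measure_mass_zero_variance:
  assumes \<xi>: "berger_measure \<omega> \<xi>"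
  shows "measure \<xi> {0} * (\<omega> 0)\<^sup>2 ^ 2 \<le> (\<omega> 0)\<^sup>2 * ((\<omega> 1)\<^sup>2 - (\<omega> 0)\<^sup>2)"
proof -
  have sets: "sets \<xi> = sets borel" and "prob_space \<xi>"
    using \<xi> by (auto simp: berger_measure_def)
  interpret prob_space \<xi> by fact
  let ?m = "(\<omega> 0)\<^sup>2"
  note int = berger_measure_integrable_power[OF \<xi>]
  have int2: "integrable \<xi> (\<lambda>t. t\<^sup>2)" and int1: "integrable \<xi> (\<lambda>t. 2 * ?m * t)"
    using int[of 2] int[of 1] by simp_all
  have expand: "(t - ?m)\<^sup>2 = t\<^sup>2 - 2 * ?m * t + ?m\<^sup>2" for t
    by (simp add: power2_eq_square algebra_simps)
  have "measure \<xi> {0} * (0 - ?m)\<^sup>2 \<le> (\<integral>t. (t - ?m)\<^sup>2 \<partial>\<xi>)"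
  proof (rule point_mass_le_integral)
    show "integrable \<xi> (\<lambda>t. (t - ?m)\<^sup>2)"
      unfolding expand by (intro Bochner_Integration.integrable_add
          Bochner_Integration.integrable_diff int1 int2) simp
  qed (use sets in \<open>auto intro: finite_measure_axioms\<close>)
  also have "\<dots> = (\<integral>t. t\<^sup>2 \<partial>\<xi>) - 2 * ?m * (\<integral>t. t \<partial>\<xi>) + ?m\<^sup>2"
    unfolding expand using int1 int2 by (simp add: prob_space)
  also have "\<dots> = ?m * ((\<omega> 1)\<^sup>2 - ?m)"
    using berger_measure_moment[OF \<xi>, of 1] berger_measure_moment[OF \<xi>, of 2]
    by (simp add: numeral_2_eq_2 lessThan_Suc algebra_simps)
  finally show ?thesis by simp
qed

text \<open>
  Here \<open>x\<close> are the weights along a boundary line and \<open>w\<close> the transversal ones; the recursion for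
  \<open>w\<close> is commutativity against the constant weights 1 of the interior.  It makes \<open>(w n)\<^sup>2 * \<gamma> n\<close>
  a constant \<open>c\<close>, and \<open>w n \<le> 1\<close> bounds \<open>c\<close> by every moment, hence by the limit \<open>\<xi>{1}\<close>.  Log-convexity
  of \<open>\<gamma> n - c\<close> is then the determinant inequality in disguise.
\<close>

lemma boundary_determinant_nonneg:
  assumes \<xi>: "berger_measure x \<xi>" and x: "\<And>n. 0 < x n" "\<And>n. x n \<le> 1"
    and w: "\<And>n. 1 \<le> n \<Longrightarrow> 0 < w n" "\<And>n. 1 \<le> n \<Longrightarrow> w n \<le> 1"
      "\<And>n. 1 \<le> n \<Longrightarrow> w (Suc n) * x n = w n"
    and n: "1 \<le> n"
  shows "(x n)\<^sup>2 \<le> (x (Suc n))\<^sup>2" and "(w n)\<^sup>2 \<le> 1"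
    and "(w (Suc n) - x n * w n)\<^sup>2 \<le> ((x (Suc n))\<^sup>2 - (x n)\<^sup>2) * (1 - (w n)\<^sup>2)"
proof -
  define \<gamma> where "\<gamma> n = (\<Prod>i<n. (x i)\<^sup>2)" for n
  have \<gamma>_Suc: "\<gamma> (Suc n) = \<gamma> n * (x n)\<^sup>2" for n by (simp add: \<gamma>_def)
  have \<gamma>_pos: "0 < \<gamma> n" for n unfolding \<gamma>_def by (intro prod_pos zero_less_power x)
  have moment: "(\<integral>t. t ^ n \<partial>\<xi>) = \<gamma> n" for n
    by (simp add: berger_measure_moment[OF \<xi>] \<gamma>_def)
  have w_sq: "(w n)\<^sup>2 \<le> 1" if "1 \<le> n" for n
    using w(1,2)[OF that] by (simp add: power_le_one)
  thus "(w n)\<^sup>2 \<le> 1" using n .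
  have log_convex: "(\<gamma> (Suc n) - c)\<^sup>2 \<le> (\<gamma> n - c) * (\<gamma> (Suc (Suc n)) - c)"
    if "c \<le> measure \<xi> {1}" for c n
    using berger_measure_moment_log_convex[OF \<xi> that, of n] unfolding moment .
  have "(\<gamma> n)\<^sup>2 * ((x n)\<^sup>2 * (x n)\<^sup>2) \<le> (\<gamma> n)\<^sup>2 * ((x n)\<^sup>2 * (x (Suc n))\<^sup>2)"
    using log_convex[of 0 n] by (simp add: \<gamma>_Suc power2_eq_square mult_ac)
  moreover have "0 < (\<gamma> n)\<^sup>2" "0 < (x n)\<^sup>2" using \<gamma>_pos[of n] x(1)[of n] by simp_all
  ultimately show "(x n)\<^sup>2 \<le> (x (Suc n))\<^sup>2" by (simp only: mult_le_cancel_left_pos)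
  define c where "c = (w 1)\<^sup>2 * \<gamma> 1"
  have c: "(w n)\<^sup>2 * \<gamma> n = c" if "1 \<le> n" for n
    using that
  proof (induction n rule: dec_induct)
    case (step n)
    have "(w (Suc n))\<^sup>2 * \<gamma> (Suc n) = (w (Suc n) * x n)\<^sup>2 * \<gamma> n"
      by (simp add: \<gamma>_Suc power_mult_distrib)
    thus ?case using step w(3) by simp
  qed (simp add: c_def)
  have "c \<le> measure \<xi> {1}"
  proof (rule LIMSEQ_le_const)
    show "\<gamma> \<longlonglongrightarrow> measure \<xi> {1}"
      using berger_measure_moments_tendsto_mass_one[OF \<xi>] x unfolding moment
      by (simp add: abs_le_iff less_imp_le order_trans[of _ 0])
    have "c \<le> \<gamma> n" if "1 \<le> n" for n
      using mult_right_mono[OF w_sq[OF that] less_imp_le[OF \<gamma>_pos[of n]]] c[OF that] by simp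
    thus "\<exists>N. \<forall>n\<ge>N. c \<le> \<gamma> n" by blast
  qed
  \<comment> \<open>With \<open>c = (w n)\<^sup>2 * \<gamma> n\<close> substituted, a factor \<open>\<gamma> n\<close> splits off each bracket.\<close>
  from log_convex[OF this, of n]
  have "(\<gamma> n)\<^sup>2 * ((x n)\<^sup>2 - (w n)\<^sup>2)\<^sup>2
      \<le> (\<gamma> n)\<^sup>2 * ((1 - (w n)\<^sup>2) * ((x n)\<^sup>2 * (x (Suc n))\<^sup>2 - (w n)\<^sup>2))"
    unfolding c[OF n, symmetric] by (simp add: \<gamma>_Suc power2_eq_square algebra_simps)
  hence "((x n)\<^sup>2 - (w n)\<^sup>2)\<^sup>2 \<le> (1 - (w n)\<^sup>2) * ((x n)\<^sup>2 * (x (Suc n))\<^sup>2 - (w n)\<^sup>2)"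
    using \<open>0 < (\<gamma> n)\<^sup>2\<close> by (simp only: mult_le_cancel_left_pos)
  moreover have "(x n)\<^sup>2 * (w (Suc n) - x n * w n)\<^sup>2 = (w n)\<^sup>2 * (1 - (x n)\<^sup>2)\<^sup>2"
    unfolding w(3)[OF n, symmetric] by (simp add: power2_eq_square algebra_simps)
  \<comment> \<open>The two sides of the first inequality and those of the claim, scaled by \<open>(x n)\<^sup>2\<close>, have the same difference.\<close>
  ultimately have "(x n)\<^sup>2 * (w (Suc n) - x n * w n)\<^sup>2
      \<le> (x n)\<^sup>2 * (((x (Suc n))\<^sup>2 - (x n)\<^sup>2) * (1 - (w n)\<^sup>2))"
    by (simp add: power2_eq_square algebra_simps)
  thus "(w (Suc n) - x n * w n)\<^sup>2 \<le> ((x (Suc n))\<^sup>2 - (x n)\<^sup>2) * (1 - (w n)\<^sup>2)"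
    using \<open>0 < (x n)\<^sup>2\<close> by (simp only: mult_le_cancel_left_pos)
qed


section \<open>The class SFC\<close>

lemma weight_le_onorm:
  assumes "weighted_shift_along s \<omega> T"
  shows "\<bar>\<omega> k\<bar> \<le> onorm T"
proof -
  have "bounded_linear T" "T (ket k) = \<omega> k *\<^sub>R ket (s k)"
    using assms by (auto simp: weighted_shift_along_def bounded_clinear_def)
  thus ?thesis using onorm[of T "ket k"] by (simp add: norm_ket)
qed

lemma two_variable_weighted_shift_along:
  assumes "two_variable_weighted_shift \<alpha> \<beta> T1 T2"
  shows "weighted_shift_along (\<lambda>k. k + (1, 0)) \<alpha> T1" "weighted_shift_along (\<lambda>k. k + (0, 1)) \<beta> T2"
proof -
  have "inj (\<lambda>k. k + c)" for c :: "nat \<times> nat"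
    by (rule injI) (simp add: prod_eq_iff)
  thus "weighted_shift_along (\<lambda>k. k + (1, 0)) \<alpha> T1" "weighted_shift_along (\<lambda>k. k + (0, 1)) \<beta> T2"
    using assms unfolding weighted_shift_along_def two_variable_weighted_shift_def by simp_all
qed

lemma grid_square: "range (\<lambda>k. k + (1, 0)) \<inter> range (\<lambda>k. k + (0, 1))
    \<subseteq> range (\<lambda>k. k + (0, 1) + (1, 0 :: nat) :: nat \<times> nat)"
proof
  fix m :: "nat \<times> nat"
  assume "m \<in> range (\<lambda>k. k + (1, 0)) \<inter> range (\<lambda>k. k + (0, 1))"
  then obtain i j i' j' where "m = (i + 1, j)" "m = (i', j' + 1)" by fastforce
  hence "m = (i, j') + (0, 1) + (1, 0)" by simp
  thus "m \<in> range (\<lambda>k. k + (0, 1) + (1, 0))" by blast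
qed

lemma commuting_weights:
  assumes shifts: "two_variable_weighted_shift \<alpha> \<beta> T1 T2" and comm: "T1 \<circ> T2 = T2 \<circ> T1"
  shows "\<beta> (Suc i, j) * \<alpha> (i, j) = \<alpha> (i, Suc j) * \<beta> (i, j)"
proof -
  have scale: "T1 (c *\<^sub>R x) = c *\<^sub>R T1 x" "T2 (c *\<^sub>R x) = c *\<^sub>R T2 x" for c x
    using shifts
    by (auto simp: two_variable_weighted_shift_def bounded_clinear_def linear_simps)
  have "T1 (T2 (ket (i, j))) = T2 (T1 (ket (i, j)))"
    using comm by (metis comp_apply)
  moreover have "ket (Suc i, Suc j) \<noteq> 0"
    using norm_ket by (metis norm_zero zero_neq_one)
  ultimately show ?thesis
    using shifts by (auto simp: two_variable_weighted_shift_def scale mult_ac)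
qed

text \<open>
  The six-point test is trivial in the interior, where all weights are one, and it always holds on
  the two boundary lines away from the origin, so only the origin can fail.
\<close>

lemma SFC_hyponormal_iff_origin:
  assumes SFC: "SFC K1 K2 \<alpha> \<beta> T1 T2"
    and \<xi>: "berger_measure (\<lambda>n. \<alpha> (n, 0)) \<xi>" and \<eta>: "berger_measure (\<lambda>n. \<beta> (0, n)) \<eta>"
  shows "jointly_hyponormal T1 T2 \<longleftrightarrow>
    (\<alpha> (0, 0))\<^sup>2 \<le> (\<alpha> (1, 0))\<^sup>2 \<and> (\<beta> (0, 0))\<^sup>2 \<le> (\<beta> (0, 1))\<^sup>2 \<and>
    (\<alpha> (0, 1) * \<beta> (1, 0) - \<alpha> (0, 0) * \<beta> (0, 0))\<^sup>2
      \<le> ((\<alpha> (1, 0))\<^sup>2 - (\<alpha> (0, 0))\<^sup>2) * ((\<beta> (0, 1))\<^sup>2 - (\<beta> (0, 0))\<^sup>2)"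
    (is "_ \<longleftrightarrow> ?origin")
proof -
  have shifts: "two_variable_weighted_shift \<alpha> \<beta> T1 T2" and comm: "T1 \<circ> T2 = T2 \<circ> T1"
    and flat: "\<And>i j. \<alpha> (Suc i, Suc j) = 1" "\<And>i j. \<beta> (Suc i, Suc j) = 1"
    and contr: "onorm T1 \<le> 1" "onorm T2 \<le> 1"
    using SFC by (auto simp: SFC_def)
  have pos: "0 < \<alpha> k" "0 < \<beta> k" for k
    using shifts unfolding two_variable_weighted_shift_def by blast+
  note along = two_variable_weighted_shift_along[OF shifts]
  have le1: "\<alpha> k \<le> 1" "\<beta> k \<le> 1" for k
    using weight_le_onorm[OF along(1), of k] weight_le_onorm[OF along(2), of k] contr by linarith+
  define test where "test k \<longleftrightarrow> (\<alpha> k)\<^sup>2 \<le> (\<alpha> (k + (1, 0)))\<^sup>2 \<and> (\<beta> k)\<^sup>2 \<le> (\<beta> (k + (0, 1)))\<^sup>2 \<and>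
    (\<alpha> (k + (0, 1)) * \<beta> (k + (1, 0)) - \<alpha> k * \<beta> k)\<^sup>2
      \<le> ((\<alpha> (k + (1, 0)))\<^sup>2 - (\<alpha> k)\<^sup>2) * ((\<beta> (k + (0, 1)))\<^sup>2 - (\<beta> k)\<^sup>2)" for k
  have "jointly_hyponormal T1 T2 \<longleftrightarrow> (\<forall>k. test k)"
    unfolding test_def
    by (rule six_point_test[OF along]) (use grid_square in \<open>auto simp: add_ac\<close>)
  moreover have "test (Suc i, Suc j)" for i j
    by (simp add: test_def flat)
  moreover have "test (Suc n, 0)" for n
  proof -
    have rec: "\<beta> (Suc m, 0) * \<alpha> (m, 0) = \<beta> (m, 0)" if "1 \<le> m" for m
      using commuting_weights[OF shifts comm, of m 0] flat(1)[of "m - 1" 0] that by simp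
    note boundary_determinant_nonneg[OF \<xi>, of "\<lambda>n. \<beta> (n, 0)" "Suc n",
        OF pos(1) le1(1) pos(2) le1(2) rec]
    thus ?thesis by (simp add: test_def flat)
  qed
  moreover have "test (0, Suc n)" for n
  proof -
    have rec: "\<alpha> (0, Suc m) * \<beta> (0, m) = \<alpha> (0, m)" if "1 \<le> m" for m
      using commuting_weights[OF shifts comm, of 0 m] flat(2)[of 0 "m - 1"] that by simp
    note boundary_determinant_nonneg[OF \<eta>, of "\<lambda>n. \<alpha> (0, n)" "Suc n",
        OF pos(2) le1(2) pos(1) le1(1) rec]
    thus ?thesis by (simp add: test_def flat mult.commute)
  qed
  moreover have "test (0, 0) \<longleftrightarrow> ?origin"
    by (simp add: test_def)
  moreover have "k = (0, 0) \<or> (\<exists>i j. k = (Suc i, Suc j) \<or> k = (Suc i, 0) \<or> k = (0, Suc j))" for k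
    by (cases k) (metis not0_implies_Suc)
  ultimately show ?thesis by metis
qed

lemma le_sqrt_divide_iff:
  fixes b :: real
  assumes "0 \<le> b" "0 < d"
  shows "b \<le> sqrt (n / d) \<longleftrightarrow> b\<^sup>2 * d \<le> n"
proof -
  have "b \<le> sqrt (n / d) \<longleftrightarrow> b\<^sup>2 \<le> n / d"
    using assms(1) by (metis real_le_rsqrt real_sqrt_le_iff real_sqrt_unique)
  thus ?thesis using assms(2) by (simp add: pos_le_divide_eq)
qed

theorem theorem5p3:
  fixes \<alpha> \<beta> :: "nat \<times> nat \<Rightarrow> real"
    and T1 T2 :: "(nat \<times> nat) ell2 \<Rightarrow> (nat \<times> nat) ell2"
    and x y :: "nat \<Rightarrow> real" and a :: real
    and \<xi> \<eta> \<rho> \<sigma> :: "real measure" and p q u v :: real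
  assumes "SFC TYPE('k1::complex_hilbert_space) TYPE('k2::complex_hilbert_space) \<alpha> \<beta> T1 T2"
    and "\<And>n. x n = \<alpha> (n, 0)"
    and "\<And>n. y n = \<beta> (0, n)"
    and "a = \<alpha> (0, 1)"
    and "berger_measure x \<xi>"
    and "berger_measure y \<eta>"
    and "atomic_decomposition \<xi> p q \<rho>"
    and "atomic_decomposition \<eta> u v \<sigma>"
  shows "jointly_hyponormal T1 T2 \<longleftrightarrow>
    y 0 \<le> sqrt ((x 0)\<^sup>2 * (y 1)\<^sup>2 * ((x 1)\<^sup>2 - (x 0)\<^sup>2)
      / ((x 0)\<^sup>2 * ((x 1)\<^sup>2 - (x 0)\<^sup>2) + (a\<^sup>2 - (x 0)\<^sup>2)\<^sup>2))"
proof -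
  have shifts: "two_variable_weighted_shift \<alpha> \<beta> T1 T2" and comm: "T1 \<circ> T2 = T2 \<circ> T1"
    using assms(1) by (auto simp: SFC_def)
  have pos: "0 < x 0" "0 < y 0"
    using shifts by (auto simp: two_variable_weighted_shift_def assms(2,3))
  have "0 < measure \<xi> {0}"
  proof -
    have "p \<le> measure \<xi> {0}" "0 < p"
      using assms(7) by (auto simp: atomic_decomposition_def measure_return)
    thus ?thesis by linarith
  qed
  hence "0 < (x 0)\<^sup>2 * ((x 1)\<^sup>2 - (x 0)\<^sup>2)"
    using berger_measure_mass_zero_variance[OF assms(5)] pos(1)
    by (smt (verit) mult_pos_pos zero_less_power)
  hence A: "0 < (x 1)\<^sup>2 - (x 0)\<^sup>2"
    using pos(1) by (simp add: zero_less_mult_iff)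
  let ?A = "(x 1)\<^sup>2 - (x 0)\<^sup>2" and ?D = "(y 1)\<^sup>2 - (y 0)\<^sup>2"
  let ?c = "a * \<beta> (1, 0) - x 0 * y 0"
  have "\<beta> (1, 0) * x 0 = a * y 0"
    using commuting_weights[OF shifts comm, of 0 0] by (simp add: assms(2-4))
  hence "(x 0 * ?c)\<^sup>2 = (y 0 * (a\<^sup>2 - (x 0)\<^sup>2))\<^sup>2"
    by (simp add: algebra_simps power2_eq_square)
  hence c: "(x 0)\<^sup>2 * ?c\<^sup>2 = (y 0)\<^sup>2 * (a\<^sup>2 - (x 0)\<^sup>2)\<^sup>2"
    by (simp only: power_mult_distrib)
  have "jointly_hyponormal T1 T2 \<longleftrightarrow> 0 \<le> ?A \<and> 0 \<le> ?D \<and> ?c\<^sup>2 \<le> ?A * ?D"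
    using SFC_hyponormal_iff_origin[OF assms(1), of \<xi> \<eta>] assms(5,6)
    by (simp add: assms(2,3)[symmetric] assms(4))
  (* As ?A is positive, the determinant inequality already forces ?D to be nonnegative. *)
  also have "\<dots> \<longleftrightarrow> ?c\<^sup>2 \<le> ?A * ?D"
  proof -
    have "0 \<le> ?D" if "?c\<^sup>2 \<le> ?A * ?D"
      using order_trans[OF zero_le_power2 that] A by (simp only: zero_le_mult_iff) auto
    thus ?thesis using A by auto
  qed
  also have "\<dots> \<longleftrightarrow> (x 0)\<^sup>2 * ?c\<^sup>2 \<le> (x 0)\<^sup>2 * (?A * ?D)"
    using pos(1) by simp
  also have "\<dots> \<longleftrightarrow> (y 0)\<^sup>2 * ((x 0)\<^sup>2 * ?A + (a\<^sup>2 - (x 0)\<^sup>2)\<^sup>2) \<le> (x 0)\<^sup>2 * (y 1)\<^sup>2 * ?A"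
    unfolding c by (simp add: algebra_simps)
  also have "\<dots> \<longleftrightarrow> y 0 \<le> sqrt ((x 0)\<^sup>2 * (y 1)\<^sup>2 * ?A / ((x 0)\<^sup>2 * ?A + (a\<^sup>2 - (x 0)\<^sup>2)\<^sup>2))"
    using pos A by (intro le_sqrt_divide_iff[symmetric] add_pos_nonneg mult_pos_pos) auto
  finally show ?thesis .
qed

end
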